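(* The following five identities hold: \begin{align*} &\sum_{k=0}^{\infty}\frac{\binom{2k}{k}\binom{3k}{k}}{(-216)^k}(3H_{3k}-H_k)=\left(\log\frac{8}{9}\right)\sum_{k=0}^{\infty}\frac{\binom{2k}{k}\binom{3k}{k}}{(-216)^k},\\ &\sum_{k=0}^{\infty}\frac{\binom{2k}{k}\binom{4k}{2k}}{(-192)^k}(2H_{4k}-H_{2k})=\frac{1}{2}\left(\log\frac{3}{4}\right)\sum_{k=0}^{\infty}\frac{\binom{2k}{k}\binom{4k}{2k}}{(-192)^k},\\ &\sum_{k=0}^{\infty}\frac{\binom{2k}{k}\binom{4k}{2k}}{(-4032)^k}(2H_{4k}-H_{2k})=\frac{1}{2}\left(\log\frac{63}{64}\right)\sum_{k=0}^{\infty}\frac{\binom{2k}{k}\binom{4k}{2k}}{(-4032)^k},\\ &\sum_{k=0}^{\infty}\frac{\binom{2k}{k}\binom{4k}{2k}}{72^k}(2H_{4k}-H_{2k})=(\log 3)\sum_{k=0}^{\infty}\frac{\binom{2k}{k}\binom{4k}{2k}}{72^k},\\ &\sum_{k=0}^{\infty}\frac{\binom{2k}{k}\binom{4k}{2k}}{576^k}(2H_{4k}-H_{2k})=\frac{1}{2}\left(\log\frac{9}{8}\right)\sum_{k=0}^{\infty}\frac{\binom{2k}{k}\binom{4k}{2k}}{576^k}. \end{align*}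
   Context: For a positive integer $n$, $H_n=\sum_{j=1}^{n}\frac{1}{j}$ is the $n$-th harmonic number, and $H_0=0$ (empty sum). $\log$ is the natural logarithm. *)

theory Defs
  imports "HOL-Analysis.Analysis"
begin

end

theory Submission
  imports Defs
begin

text \<open>
  Put $a_k(s) = (s)_k (1-s)_k / k!^2$. Up to the geometric factor, the summands are $a_k(1/3)$ and
  $a_k(1/4)$, and the harmonic factors are multiples of the logarithmic derivative at $t = 0$ of
  $(s+t)_k (1-s+t)_k$. Differentiating Euler's transformation of
  ${}_2F_1(s+t, 1-s+t; 1; z)$ at $t = 0$ therefore suggests $\sum_k a_k h_k z^k = -\log(1-z)
  \sum_k a_k z^k$ with $h_k = \sum_{j<k} (1/(j+s) + 1/(j+1-s))$. Comparing coefficients, this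
  amounts to the finite identity $a_k h_k = \sum_{j<k} a_j/(k-j)$, both sides of which
  satisfy the same first-order recurrence in $k$.
\<close>

text \<open>The term \<open>i = k\<close> of the sum vanishes, because division by zero yields zero.\<close>

lemma log_convolution_unique:
  fixes a g :: "nat \<Rightarrow> 'a::field_char_0" and p :: 'a
  assumes a: "\<And>k. (of_nat k + 1)^2 * a (Suc k) = (of_nat k^2 + of_nat k + p) * a k"
    and g0: "g 0 = 0"
    and g: "\<And>k. (of_nat k + 1)^2 * g (Suc k) =
                 (of_nat k^2 + of_nat k + p) * g k + (2 * of_nat k + 1) * a k"
  shows "g k = (\<Sum>i\<le>k. a i / of_nat (k - i))"
proof (induction k)
  case 0
  show ?case by (simp add: g0)
next
  case (Suc k)
  define n :: 'a where "n = of_nat k"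
  define S where "S = (\<Sum>i\<le>Suc k. a i / of_nat (Suc k - i))"
  have n1: "n + 1 \<noteq> 0"
    unfolding n_def by (metis of_nat_Suc of_nat_neq_0 add.commute)
  \<comment> \<open>Write (n+1)^2 = (n+1-i)(n+1+i) + i^2; the first product cancels the denominator
    n+1-i.\<close>
  have split_sq: "(n + 1)^2 * (a i / of_nat (Suc k - i)) =
      (n + 1 + of_nat i) * a i + of_nat i^2 * a i / of_nat (Suc k - i)" if "i \<le> k" for i
  proof -
    have "(of_nat (Suc k - i) :: 'a) \<noteq> 0"
      using that by (simp only: of_nat_eq_0_iff)
    moreover have "(of_nat (Suc k - i) :: 'a) = n + 1 - of_nat i"
      using that by (simp add: n_def of_nat_diff)
    ultimately show ?thesis
      by (simp add: divide_simps) (simp add: algebra_simps power2_eq_square)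
  qed
  \<comment> \<open>The factor i^2 kills the term i = 0, so the index can move down by one. This
    turns the denominator into k-i and the numerator into the left side of the recurrence for
    \<open>a\<close>.\<close>
  have shift: "(\<Sum>i\<le>k. of_nat i^2 * a i / of_nat (Suc k - i)) =
      (\<Sum>i<k. (of_nat i^2 + of_nat i + p) * a i / of_nat (k - i))"
  proof -
    have "(\<Sum>i\<le>k. of_nat i^2 * a i / of_nat (Suc k - i)) =
        (\<Sum>i<k. (of_nat i + 1)^2 * a (Suc i) / of_nat (k - i))"
      by (simp add: lessThan_Suc_atMost[symmetric] sum.lessThan_Suc_shift add.commute
               del: sum.lessThan_Suc)
    then show ?thesis by (simp only: a)
  qed
  \<comment> \<open>Here (n^2+n+p) - (i^2+i+p) = (n-i)(n+i+1), so \<open>p\<close> cancels and the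
    correction to the convolution sum is again free of denominators.\<close>
  have merge: "(of_nat i^2 + of_nat i + p) * a i / of_nat (k - i) =
      (n^2 + n + p) * (a i / of_nat (k - i)) - (n + 1 + of_nat i) * a i" if "i < k" for i
  proof -
    have "(of_nat (k - i) :: 'a) \<noteq> 0"
      using that by (simp only: of_nat_eq_0_iff)
    moreover have "(of_nat (k - i) :: 'a) = n - of_nat i"
      using that by (simp add: n_def of_nat_diff)
    ultimately show ?thesis
      by (simp add: divide_simps) (simp add: algebra_simps power2_eq_square)
  qed
  \<comment> \<open>The top term \<open>i = Suc k\<close> of \<open>S\<close> is a division by zero
    and drops out.\<close>
  have "(n + 1)^2 * S = (\<Sum>i\<le>k. (n + 1)^2 * (a i / of_nat (Suc k - i)))"
    by (simp add: S_def sum_distrib_left distrib_left)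
  also have "\<dots> = (\<Sum>i\<le>k. (n + 1 + of_nat i) * a i) +
      (\<Sum>i\<le>k. of_nat i^2 * a i / of_nat (Suc k - i))"
    by (simp only: sum.distrib[symmetric]) (rule sum.cong, simp, rule split_sq, simp)
  also have "\<dots> = (\<Sum>i\<le>k. (n + 1 + of_nat i) * a i) +
      ((n^2 + n + p) * (\<Sum>i<k. a i / of_nat (k - i)) - (\<Sum>i<k. (n + 1 + of_nat i) * a i))"
    by (simp only: shift sum_distrib_left sum_subtractf[symmetric])
       (intro arg_cong2[where f = "(+)"] refl sum.cong, rule merge, simp)
  \<comment> \<open>The two denominator-free sums differ only in their term at i = k, which leaves
    the inhomogeneous part (2n+1) a_k.\<close>
  also have "\<dots> = (n^2 + n + p) * (\<Sum>i\<le>k. a i / of_nat (k - i)) + (2 * n + 1) * a k"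
    by (simp add: lessThan_Suc_atMost[symmetric] n_def algebra_simps)
  also have "\<dots> = (n + 1)^2 * g (Suc k)"
    by (simp only: g n_def Suc.IH)
  finally show ?case
    using n1 by (simp add: S_def)
qed

text \<open>With p = s(1-s) one has k^2+k+p = (k+s)(k+1-s), so the increment of \<open>h\<close> is
  1/(k+s) + 1/(k+1-s). By the finite identity, a_k h_k z^k is the k-th term of the Cauchy product of
  the series of \<open>a\<close> with that of -log(1-z); both converge absolutely for |z| <
  1.\<close>

lemma sums_log_derivative:
  fixes a h :: "nat \<Rightarrow> real" and p z :: real
  assumes a: "\<And>k. (real k + 1)^2 * a (Suc k) = (real k^2 + real k + p) * a k"
    and h0: "h 0 = 0"
    and h: "\<And>k. h (Suc k) = h k + (2 * real k + 1) / (real k^2 + real k + p)"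
    and p: "0 < p" "p \<le> 1" and z: "\<bar>z\<bar> < 1"
  shows "summable (\<lambda>k. a k * z^k)"
    and "(\<lambda>k. a k * z^k * h k) sums (- ln (1 - z) * (\<Sum>k. a k * z^k))"
proof -
  \<comment> \<open>The ratio of consecutive terms is at most 1, since (k+1)^2 - (k^2+k+p) = k+1-p
    is nonnegative.\<close>
  have bound: "\<bar>a k\<bar> \<le> \<bar>a 0\<bar>" for k
  proof (induction k)
    case (Suc k)
    have "(real k + 1)^2 * \<bar>a (Suc k)\<bar> = (real k^2 + real k + p) * \<bar>a k\<bar>"
      using arg_cong[OF a[of k], of abs] p by (simp add: abs_mult)
    also have "\<dots> \<le> (real k + 1)^2 * \<bar>a k\<bar>"
      using p by (intro mult_right_mono) (auto simp: power2_eq_square algebra_simps)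
    finally have "\<bar>a (Suc k)\<bar> \<le> \<bar>a k\<bar>"
      by (rule mult_left_le_imp_le) simp
    with Suc.IH show ?case by simp
  qed simp
  have norm_a: "summable (\<lambda>k. norm (a k * z^k))"
  proof (rule summable_norm_comparison_test[OF exI[of _ 0]])
    show "\<forall>k\<ge>0. norm (a k * z^k) \<le> \<bar>a 0\<bar> * \<bar>z\<bar>^k"
      using bound by (auto simp: abs_mult power_abs intro!: mult_right_mono)
    show "summable (\<lambda>k. \<bar>a 0\<bar> * \<bar>z\<bar>^k)"
      using z by (intro summable_mult summable_geometric) simp
  qed
  then show "summable (\<lambda>k. a k * z^k)"
    by (rule summable_norm_cancel)
  have "(\<lambda>k. - (z^k) / real k) sums ln (1 - z)"
    using ln_series'[of "-z"] z by simp
  \<comment> \<open>Indexing from 0 is harmless: the term at k = 0 is 1/0, which is zero.\<close>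
  then have log: "(\<lambda>k. z^k / real k) sums (- ln (1 - z))"
    using sums_minus by fastforce
  have norm_log: "summable (\<lambda>k. norm (z^k / real k))"
  proof (rule summable_norm_comparison_test[OF exI[of _ 0]])
    show "\<forall>k\<ge>0. norm (z^k / real k) \<le> \<bar>z\<bar>^k"
    proof (intro allI impI)
      fix k
      show "norm (z^k / real k) \<le> \<bar>z\<bar>^k"
        by (cases k) (auto simp: abs_mult power_abs field_simps)
    qed
    show "summable (\<lambda>k. \<bar>z\<bar>^k)"
      using z by (intro summable_geometric) simp
  qed
  \<comment> \<open>Multiplying the increment of \<open>h\<close> by (k^2+k+p) a_k gives the
    inhomogeneous recurrence for the product a_k h_k.\<close>
  have ah: "a k * h k = (\<Sum>i\<le>k. a i / real (k - i))" for k
  proof (rule log_convolution_unique[OF a])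
    show "(real k + 1)^2 * (a (Suc k) * h (Suc k)) =
        (real k^2 + real k + p) * (a k * h k) + (2 * real k + 1) * a k" for k
    proof -
      define q where "q = real k^2 + real k + p"
      have q: "q \<noteq> 0"
        using p by (auto simp: q_def intro!: less_imp_neq[symmetric] add_nonneg_pos)
      have "(real k + 1)^2 * (a (Suc k) * h (Suc k)) = q * a k * h (Suc k)"
        using a[of k] by (simp add: q_def)
      also have "\<dots> = q * (a k * h k) + (2 * real k + 1) * a k"
        using q by (simp only: h q_def[symmetric]) (simp add: field_simps)
      finally show ?thesis by (simp add: q_def)
    qed
  qed (simp add: h0)
  have "(\<Sum>i\<le>k. a i * z^i * (z^(k - i) / real (k - i))) = a k * z^k * h k" for k
  proof -
    have "(\<Sum>i\<le>k. a i * z^i * (z^(k - i) / real (k - i))) = (\<Sum>i\<le>k. z^k * (a i / real (k - i)))"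
      by (intro sum.cong) (auto simp flip: power_add)
    also have "\<dots> = z^k * (a k * h k)"
      by (simp add: ah sum_distrib_left)
    finally show ?thesis by (simp add: mult_ac)
  qed
  with Cauchy_product_sums[OF norm_a norm_log]
  show "(\<lambda>k. a k * z^k * h k) sums (- ln (1 - z) * (\<Sum>k. a k * z^k))"
    by (simp add: sums_unique[OF log, symmetric] mult.commute)
qed

lemma binomial_product_3:
  "real ((2 * k) choose k) * real ((3 * k) choose k) = fact (3 * k) / fact k^3"
  by (simp add: binomial_fact power3_eq_cube)

lemma binomial_product_4:
  "real ((2 * k) choose k) * real ((4 * k) choose (2 * k)) = fact (4 * k) / (fact (2 * k) * fact k^2)"
  by (simp add: binomial_fact power2_eq_square)

text \<open>This is the case s = 1/3, p = 2/9, z = 27/w: dividing (3k)!/k!^3 by 27^k gives (1/3)_k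
  (2/3)_k / k!^2.\<close>

lemma binomial_3_harm_sums:
  fixes w :: real
  assumes w: "\<bar>w\<bar> > 27"
  shows "summable (\<lambda>k. real ((2 * k) choose k) * real ((3 * k) choose k) / w^k)" (is ?S)
    and "(\<lambda>k. real ((2 * k) choose k) * real ((3 * k) choose k) / w^k * (3 * harm (3 * k) - harm k))
      sums (- ln (1 - 27 / w) * (\<Sum>k. real ((2 * k) choose k) * real ((3 * k) choose k) / w^k))"
      (is ?T)
proof -
  define a where "a k = real ((2 * k) choose k) * real ((3 * k) choose k) / 27^k" for k
  define h :: "nat \<Rightarrow> real" where "h k = 3 * harm (3 * k) - harm k" for k
  have az: "a k * (27 / w)^k = real ((2 * k) choose k) * real ((3 * k) choose k) / w^k" for k
    by (simp add: a_def power_divide)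
  have three: "3 * Suc k = Suc (Suc (Suc (3 * k)))" for k
    by simp
  have a: "(real k + 1)^2 * a (Suc k) = (real k^2 + real k + 2/9) * a k" for k
  proof -
    define F f :: real where "F = fact (3 * k)" and "f = fact k"
    have F: "(fact (3 * Suc k) :: real) = (3 * k + 3) * (3 * k + 2) * (3 * k + 1) * F"
      unfolding three fact_Suc F_def by (simp add: algebra_simps)
    have f: "(fact (Suc k) :: real) = (k + 1) * f" "f \<noteq> 0"
      by (simp_all add: f_def algebra_simps)
    have n: "real k + 1 \<noteq> 0"
      by linarith
    have "a (Suc k) = (3 * k + 3) * (3 * k + 2) * (3 * k + 1) * F / (((k + 1) * f)^3 * (27 * 27^k))"
      unfolding a_def binomial_product_3 F f(1) by simp
    moreover have "a k = F / (f^3 * 27^k)"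
      unfolding a_def binomial_product_3 F_def f_def by simp
    ultimately show ?thesis
      using f(2) n by (simp only:) (simp add: divide_simps, simp add: algebra_simps power2_eq_square power3_eq_cube)
  qed
  have h: "h (Suc k) = h k + (2 * real k + 1) / (real k^2 + real k + 2/9)" for k
  proof -
    have *: "real k^2 + real k + 2/9 = (3 * real k + 1) * (3 * real k + 2) / 9"
      by (simp add: power2_eq_square algebra_simps)
    have "h (Suc k) - h k = 3 / (3 * real k + 1) + 3 / (3 * real k + 2) + 3 / (3 * real k + 3)
        - 1 / (real k + 1)"
      unfolding h_def three harm_Suc by (simp add: inverse_eq_divide algebra_simps)
    \<comment> \<open>The new multiple of three in H_{3k} cancels the increment of H_k, leaving
      1/(k+1/3) + 1/(k+2/3).\<close>
    also have "3 / (3 * real k + 3) = 1 / (real k + 1)"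
      by (simp add: divide_simps)
    also have "3 / (3 * real k + 1) + 3 / (3 * real k + 2) + 1 / (real k + 1) - 1 / (real k + 1)
        = (2 * real k + 1) / (real k^2 + real k + 2/9)"
      unfolding * by (simp add: divide_simps add_nonneg_eq_0_iff)
    finally show ?thesis by simp
  qed
  have z: "\<bar>27 / w\<bar> < 1"
    using w by (simp add: abs_divide divide_simps)
  note * = sums_log_derivative[of a "2/9" h, OF a _ h _ _ z]
  show ?S using *(1) by (simp add: az h_def harm_def)
  show ?T using *(2) by (simp add: az h_def harm_def)
qed

text \<open>This is the case s = 1/4, p = 3/16, z = 64/w. The harmonic factor grows by only half of
  1/(k+1/4) + 1/(k+3/4), so \<open>h\<close> is its double and the logarithm is halved.\<close>

lemma binomial_4_harm_sums:
  fixes w :: real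
  assumes w: "\<bar>w\<bar> > 64"
  shows "summable (\<lambda>k. real ((2 * k) choose k) * real ((4 * k) choose (2 * k)) / w^k)" (is ?S)
    and "(\<lambda>k. real ((2 * k) choose k) * real ((4 * k) choose (2 * k)) / w^k
        * (2 * harm (4 * k) - harm (2 * k)))
      sums (- ln (1 - 64 / w) / 2 * (\<Sum>k. real ((2 * k) choose k) * real ((4 * k) choose (2 * k)) / w^k))"
      (is ?T)
proof -
  define a where "a k = real ((2 * k) choose k) * real ((4 * k) choose (2 * k)) / 64^k" for k
  define h :: "nat \<Rightarrow> real" where "h k = 2 * (2 * harm (4 * k) - harm (2 * k))" for k
  have az: "a k * (64 / w)^k = real ((2 * k) choose k) * real ((4 * k) choose (2 * k)) / w^k" for k
    by (simp add: a_def power_divide)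
  have half: "1/2 * (c * h k) = c * (2 * harm (4 * k) - harm (2 * k))" for c k
    by (simp add: h_def)
  have four: "4 * Suc k = Suc (Suc (Suc (Suc (4 * k))))" and two: "2 * Suc k = Suc (Suc (2 * k))" for k
    by simp_all
  have a: "(real k + 1)^2 * a (Suc k) = (real k^2 + real k + 3/16) * a k" for k
  proof -
    define F G f :: real where "F = fact (4 * k)" and "G = fact (2 * k)" and "f = fact k"
    \<comment> \<open>\<open>Q\<close> is the growth factor of (2k)!. It also occurs in that of
      (4k)!, as (4k+4)(4k+2) = 4Q, so it cancels and 64 becomes 16.\<close>
    define Q where "Q = (2 * real k + 2) * (2 * real k + 1)"
    have Q: "Q \<noteq> 0"
      by (simp add: Q_def add_nonneg_eq_0_iff)
    have F: "(fact (4 * Suc k) :: real) = 4 * Q * (4 * k + 3) * (4 * k + 1) * F"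
      unfolding four fact_Suc F_def Q_def by (simp add: algebra_simps)
    have G: "(fact (2 * Suc k) :: real) = Q * G" "G \<noteq> 0"
      unfolding two fact_Suc G_def Q_def by (simp_all add: algebra_simps)
    have f: "(fact (Suc k) :: real) = (k + 1) * f" "f \<noteq> 0"
      by (simp_all add: f_def algebra_simps)
    have n: "real k + 1 \<noteq> 0"
      by linarith
    have "a (Suc k) = (4 * k + 3) * (4 * k + 1) * F / (G * ((k + 1) * f)^2 * (16 * 64^k))"
      unfolding a_def binomial_product_4 F G(1) f(1) using Q
      by (simp add: divide_simps) (simp add: algebra_simps)
    moreover have "a k = F / (G * f^2 * 64^k)"
      unfolding a_def binomial_product_4 F_def f_def G_def by simp
    ultimately show ?thesis
      using f(2) G(2) n by (simp only:) (simp add: divide_simps, simp add: algebra_simps power2_eq_square)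
  qed
  have h: "h (Suc k) = h k + (2 * real k + 1) / (real k^2 + real k + 3/16)" for k
  proof -
    have *: "real k^2 + real k + 3/16 = (4 * real k + 1) * (4 * real k + 3) / 16"
      by (simp add: power2_eq_square algebra_simps)
    have "h (Suc k) - h k = 4 / (4 * real k + 1) + 4 / (4 * real k + 2) + 4 / (4 * real k + 3)
        + 4 / (4 * real k + 4) - 2 / (2 * real k + 1) - 2 / (2 * real k + 2)"
      unfolding h_def four two harm_Suc by (simp add: inverse_eq_divide algebra_simps)
    \<comment> \<open>The even denominators from H_{4k} cancel the increment of H_{2k}.\<close>
    also have "4 / (4 * real k + 2) = 2 / (2 * real k + 1)"
      by (simp add: divide_simps)
    also have "4 / (4 * real k + 4) = 2 / (2 * real k + 2)"
      by (simp add: divide_simps)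
    also have "4 / (4 * real k + 1) + 2 / (2 * real k + 1) + 4 / (4 * real k + 3)
        + 2 / (2 * real k + 2) - 2 / (2 * real k + 1) - 2 / (2 * real k + 2)
        = (2 * real k + 1) / (real k^2 + real k + 3/16)"
      unfolding * by (simp add: divide_simps add_nonneg_eq_0_iff) (simp add: algebra_simps)
    finally show ?thesis by simp
  qed
  have z: "\<bar>64 / w\<bar> < 1"
    using w by (simp add: abs_divide divide_simps)
  note * = sums_log_derivative[of a "3/16" h, OF a _ h _ _ z]
  show ?S using *(1) by (simp add: az h_def harm_def)
  have "(\<lambda>k. a k * (64 / w)^k * h k) sums (- ln (1 - 64 / w) * (\<Sum>k. a k * (64 / w)^k))"
    by (rule *(2)) (simp_all add: h_def harm_def)
  from sums_mult[OF this, of "1/2"] show ?T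
    by (simp only: az half) simp
qed

theorem theorem1p1:
  shows
    "summable (\<lambda>k. real ((2 * k) choose k) * real ((3 * k) choose k) / (-216) ^ k) \<and>
     (\<lambda>k. real ((2 * k) choose k) * real ((3 * k) choose k) / (-216) ^ k * (3 * harm (3 * k) - harm k))
       sums (ln (8 / 9) * (\<Sum>k. real ((2 * k) choose k) * real ((3 * k) choose k) / (-216) ^ k)) \<and>

     summable (\<lambda>k. real ((2 * k) choose k) * real ((4 * k) choose (2 * k)) / (-192) ^ k) \<and>
     (\<lambda>k. real ((2 * k) choose k) * real ((4 * k) choose (2 * k)) / (-192) ^ k * (2 * harm (4 * k) - harm (2 * k)))
       sums (1 / 2 * ln (3 / 4) * (\<Sum>k. real ((2 * k) choose k) * real ((4 * k) choose (2 * k)) / (-192) ^ k)) \<and>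

     summable (\<lambda>k. real ((2 * k) choose k) * real ((4 * k) choose (2 * k)) / (-4032) ^ k) \<and>
     (\<lambda>k. real ((2 * k) choose k) * real ((4 * k) choose (2 * k)) / (-4032) ^ k * (2 * harm (4 * k) - harm (2 * k)))
       sums (1 / 2 * ln (63 / 64) * (\<Sum>k. real ((2 * k) choose k) * real ((4 * k) choose (2 * k)) / (-4032) ^ k)) \<and>

     summable (\<lambda>k. real ((2 * k) choose k) * real ((4 * k) choose (2 * k)) / 72 ^ k) \<and>
     (\<lambda>k. real ((2 * k) choose k) * real ((4 * k) choose (2 * k)) / 72 ^ k * (2 * harm (4 * k) - harm (2 * k)))
       sums (ln 3 * (\<Sum>k. real ((2 * k) choose k) * real ((4 * k) choose (2 * k)) / 72 ^ k)) \<and>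

     summable (\<lambda>k. real ((2 * k) choose k) * real ((4 * k) choose (2 * k)) / 576 ^ k) \<and>
     (\<lambda>k. real ((2 * k) choose k) * real ((4 * k) choose (2 * k)) / 576 ^ k * (2 * harm (4 * k) - harm (2 * k)))
       sums (1 / 2 * ln (9 / 8) * (\<Sum>k. real ((2 * k) choose k) * real ((4 * k) choose (2 * k)) / 576 ^ k))"
proof -
  \<comment> \<open>The values of 1-z are 9/8, 4/3, 64/63, 1/9 and 8/9, in the order of the
    identities; the minus sign inverts them. For w = 72 half of log 9 is log 3.\<close>
  have ln_rcp: "- ln x = ln (inverse x)" if "x > 0" for x :: real
    using that by (simp add: ln_inverse)
  have ln9: "ln 9 = 2 * ln (3::real)"
    using ln_realpow[of 3 2] by simp
  show ?thesis
    using binomial_3_harm_sums[of "-216"] binomial_4_harm_sums[of "-192"]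
      binomial_4_harm_sums[of "-4032"] binomial_4_harm_sums[of 72] binomial_4_harm_sums[of 576]
    by (simp add: ln_rcp ln9)
qed

end
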